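(* For any integer $k\ge 0$ and $a$ a congruence class modulo $3$, the order type of $\mathscr{D}^a\cap[0,t_a(k)]$ and the order type of $\mathscr{D}^a_{st}\cap[0,t_a(k)]$ are both equal to $\omega^k$.
   Context: Natural numbers are positive integers. The complexity $\|n\|$ of a natural number $n$ is the least number of $1$'s needed to write $n$ using any combination of addition and multiplication (with arbitrary parenthesization). The defect of $n$ is $\delta(n)=\|n\|-3\log_3 n$. For $a$ a congruence class modulo $3$, $\mathscr{D}^a=\{\delta(n): \|n\|\equiv a \pmod 3,\ n\neq 1\}$. It is known that each $\mathscr{D}^a$ is a well-ordered subset of $\mathbb{R}$ of order type $\omega^\omega$. A natural number $m$ is stable if $\|3^k m\|=3k+\|m\|$ for every $k\ge 0$. $\mathscr{D}_{st}$ is the set of all $\delta(n)$ with $n$ stable, and $\mathscr{D}^a_{st}=\mathscr{D}^a\cap\mathscr{D}_{st}$. For $a$ a congruence class modulo $3$ and $k\ge 0$ an integer, $t_a(k)=k$ if $k\equiv a\pmod 3$, $t_a(k)=k+\delta(2)$ if $k\equiv a+1\pmod 3$, and $t_a(k)=k+2\delta(2)$ if $k\equiv a+2\pmod 3$. Here $\omega^k$ is ordinal exponentiation, with $\omega^0=1$. *)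

theory Defs
  imports Complex_Main "HOL-Number_Theory.Cong"
begin

section \<open>Integer complexity and defect\<close>

unbundle cardinal_syntax

datatype ones_expr = One | Plus ones_expr ones_expr | Times ones_expr ones_expr

primrec expr_val :: "ones_expr \<Rightarrow> nat" where
  "expr_val One = 1"
| "expr_val (Plus e f) = expr_val e + expr_val f"
| "expr_val (Times e f) = expr_val e * expr_val f"

primrec ones_count :: "ones_expr \<Rightarrow> nat" where
  "ones_count One = 1"
| "ones_count (Plus e f) = ones_count e + ones_count f"
| "ones_count (Times e f) = ones_count e + ones_count f"

text \<open>Meaningful for \<open>n > 0\<close> only: no expression has value \<open>0\<close>.\<close>

definition complexity :: "nat \<Rightarrow> nat" where
  "complexity n = (LEAST c. \<exists>e. expr_val e = n \<and> ones_count e = c)"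

definition defect :: "nat \<Rightarrow> real" where
  "defect n = real (complexity n) - 3 * log 3 (real n)"

definition stable :: "nat \<Rightarrow> bool" where
  "stable m \<longleftrightarrow> m > 0 \<and> (\<forall>k. complexity (3 ^ k * m) = 3 * k + complexity m)"

text \<open>A congruence class modulo 3 is given by any integer \<open>a\<close> representing it; the
  notions below depend on \<open>a\<close> only modulo 3.\<close>

definition defects_class :: "int \<Rightarrow> real set" where
  "defects_class a = {defect n | n. n > 0 \<and> n \<noteq> 1 \<and> [int (complexity n) = a] (mod 3)}"

definition stable_defects :: "real set" where
  "stable_defects = {defect n | n. stable n}"

definition stable_defects_class :: "int \<Rightarrow> real set" where
  "stable_defects_class a = defects_class a \<inter> stable_defects"

text \<open>The last branch is the case \<open>k \<equiv> a + 2\<close> modulo 3.\<close>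

definition threshold :: "int \<Rightarrow> nat \<Rightarrow> real" where
  "threshold a k =
    (if [int k = a] (mod 3) then real k
     else if [int k = a + 1] (mod 3) then real k + defect 2
     else real k + 2 * defect 2)"


section \<open>Finite powers of \<open>\<omega>\<close>\<close>

text \<open>The ordinal product \<open>\<alpha> \<cdot> \<beta>\<close>: \<open>\<beta>\<close> copies of \<open>\<alpha>\<close>, so the second component is the more
  significant one. As in \<open>BNF_Wellorder_Constructions\<close>, ordinals are reflexive well-order
  relations taken up to \<open>=o\<close>.\<close>

definition ord_prod :: "'a rel \<Rightarrow> 'b rel \<Rightarrow> ('a \<times> 'b) rel" where
  "ord_prod r s = {((x, i), (y, j)). x \<in> Field r \<and> y \<in> Field r \<and>
     ((i, j) \<in> s - Id \<or> i = j \<and> i \<in> Field s \<and> (x, y) \<in> r)}"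

text \<open>The recursion \<open>\<omega>\<^sup>0 = 1\<close>, \<open>\<omega>\<^bsup>k+1\<^esup> = \<omega>\<^sup>k \<cdot> \<omega>\<close>, where \<open>\<omega>\<close> is \<^const>\<open>natLeq\<close>. The product is
  transported along \<open>(xs, n) \<mapsto> n # xs\<close> only to keep all powers in one type.\<close>

primrec omega_pow :: "nat \<Rightarrow> nat list rel" where
  "omega_pow 0 = {([], [])}"
| "omega_pow (Suc k) = dir_image (ord_prod (omega_pow k) natLeq) (\<lambda>(xs, n). n # xs)"

definition has_order_type :: "real set \<Rightarrow> 'a rel \<Rightarrow> bool" where
  "has_order_type S r \<longleftrightarrow> relation_of (\<le>) S =o r"

lemma Field_ord_prod:
  assumes "Refl r" "Refl s"
  shows "Field (ord_prod r s) = Field r \<times> Field s"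
  using assms unfolding ord_prod_def Field_def refl_on_def by fast

lemma Well_order_ord_prod:
  assumes r: "Well_order r" and s: "Well_order s"
  shows "Well_order (ord_prod r s)"
proof -
  have rr: "Refl r" "trans r" "antisym r" "total_on (Field r) r" "wf (r - Id)"
    and ss: "Refl s" "trans s" "antisym s" "total_on (Field s) s" "wf (s - Id)"
    using r s by (auto simp: order_on_defs)
  note F = Field_ord_prod[OF rr(1) ss(1)]
  have "Refl (ord_prod r s)"
    unfolding refl_on_def F using rr(1) by (auto simp: refl_on_def ord_prod_def)
  moreover have "trans (ord_prod r s)"
  proof (rule transI, clarify)
    fix x i y j z k
    assume *: "((x, i), (y, j)) \<in> ord_prod r s" "((y, j), (z, k)) \<in> ord_prod r s"
    have "(i, k) \<in> s - Id" if "(i, j) \<in> s - Id" "(j, k) \<in> s - Id"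
      using that ss(2,3) by (auto dest: transD antisymD)
    moreover have "(x, z) \<in> r" if "(x, y) \<in> r" "(y, z) \<in> r"
      using that rr(2) by (rule transD[rotated])
    ultimately show "((x, i), (z, k)) \<in> ord_prod r s"
      using * unfolding ord_prod_def by auto
  qed
  moreover have "antisym (ord_prod r s)"
    using rr(3) ss(3) unfolding antisym_def ord_prod_def by auto
  moreover have "total_on (Field (ord_prod r s)) (ord_prod r s)"
  proof (unfold F, rule total_onI, clarify)
    fix x i y j
    assume *: "x \<in> Field r" "i \<in> Field s" "y \<in> Field r" "j \<in> Field s"
      "((y, j), (x, i)) \<notin> ord_prod r s"
    then show "((x, i), (y, j)) \<in> ord_prod r s"
      using rr(1,4) ss(4) by (cases "i = j"; cases "x = y")
        (auto simp: ord_prod_def total_on_def refl_on_def)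
  qed
  moreover have "wf (ord_prod r s - Id)"
  proof (rule wf_subset)
    show "wf (inv_image ((s - Id) <*lex*> (r - Id)) prod.swap)"
      using rr(5) ss(5) by (intro wf_inv_image wf_lex_prod)
    show "ord_prod r s - Id \<subseteq> inv_image ((s - Id) <*lex*> (r - Id)) prod.swap"
      by (auto simp: ord_prod_def inv_image_def)
  qed
  moreover have "ord_prod r s \<subseteq> Field (ord_prod r s) \<times> Field (ord_prod r s)"
    by (auto intro: FieldI1 FieldI2)
  ultimately show ?thesis
    by (auto simp: order_on_defs)
qed

lemma inj_cons: "inj_on (\<lambda>(xs, n). n # xs) A"
  by (auto simp: inj_on_def)

lemma Well_order_omega_pow: "Well_order (omega_pow k)"
proof (induction k)
  case 0
  show ?case
    by (auto simp: order_on_defs refl_on_def trans_def antisym_def total_on_def Field_def)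
next
  case (Suc k)
  show ?case
    unfolding omega_pow.simps
    by (rule Well_order_dir_image[OF Well_order_ord_prod[OF Suc natLeq_Well_order] inj_cons])
qed

lemma Field_omega_pow: "Field (omega_pow k) = {xs. length xs = k}"
proof (induction k)
  case 0
  show ?case by (auto simp: Field_def)
next
  case (Suc k)
  have "Field (ord_prod (omega_pow k) natLeq) = Field (omega_pow k) \<times> UNIV"
    using Well_order_omega_pow[of k] natLeq_Well_order
    by (subst Field_ord_prod) (auto simp: order_on_defs Field_natLeq)
  then show ?case
    by (auto simp: dir_image_Field Suc length_Suc_conv image_iff)
qed

lemma omega_pow_Suc: "omega_pow (Suc k) =o ord_prod (omega_pow k) natLeq"
proof -
  have "ord_prod (omega_pow k) natLeq =o omega_pow (Suc k)"
    unfolding omega_pow.simps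
    by (rule dir_image_ordIso[OF Well_order_ord_prod[OF Well_order_omega_pow natLeq_Well_order]
          inj_cons])
  then show ?thesis by (rule ordIso_symmetric)
qed

end

theory Submission
  imports Defs "HOL-Analysis.Elementary_Metric_Spaces"
begin

text \<open>
  Dropping a bounded summand from an optimal representation of \<open>n\<close> changes the defect by almost
  exactly a positive integer. Hence a limit point of the defects is approached from below, and it
  is a defect plus a positive integer, of matching residue modulo 3. Iterating, the supremum of a
  set of defects of order type \<open>\<omega>\<^sup>k\<close> is a defect plus an integer at least \<open>k\<close>, and
  the least such number in the residue class is the threshold; this bounds the order types from
  above. Conversely, if \<open>n\<close> is stable then so is \<open>3\<^sup>e n + 1\<close> for all large \<open>e\<close>, with
  defect increasing to \<open>defect n + 1\<close>; nesting this construction \<open>k\<close> times, starting from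
  2, 3 or 4, gives a set of stable defects of order type \<open>\<omega>\<^sup>k\<close> below the threshold.
\<close>

section \<open>Complexity\<close>

lemma expr_val_pos: "expr_val e > 0"
  by (induction e) auto

lemma ones_count_pos: "ones_count e > 0"
  by (induction e) auto

lemma complexity_le: "complexity (expr_val e) \<le> ones_count e"
  unfolding complexity_def by (rule Least_le) blast

lemma complexity_expr:
  assumes "n > 0"
  obtains e where "expr_val e = n" "ones_count e = complexity n"
proof -
  have "\<exists>e. expr_val e = n"
    using assms
  proof (induction n rule: nat_induct_non_zero)
    case 1
    show ?case by (rule exI[of _ One]) simp
  next
    case (Suc n)
    then obtain e where "expr_val e = n" by blast
    then show ?case by (intro exI[of _ "Plus e One"]) simp
  qed
  then have "\<exists>e. expr_val e = n \<and> ones_count e = complexity n"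
    unfolding complexity_def
    using LeastI_ex[of "\<lambda>c. \<exists>e. expr_val e = n \<and> ones_count e = c"] by blast
  then show ?thesis using that by blast
qed

lemma complexity_pos: "n > 0 \<Longrightarrow> complexity n > 0"
  by (erule complexity_expr) (metis ones_count_pos)

lemma complexity_add_le:
  assumes "m > 0" "n > 0"
  shows "complexity (m + n) \<le> complexity m + complexity n"
proof -
  obtain e where "expr_val e = m" "ones_count e = complexity m"
    using complexity_expr[OF assms(1)] .
  moreover obtain f where "expr_val f = n" "ones_count f = complexity n"
    using complexity_expr[OF assms(2)] .
  ultimately show ?thesis using complexity_le[of "Plus e f"] by simp
qed

lemma complexity_mult_le:
  assumes "m > 0" "n > 0"
  shows "complexity (m * n) \<le> complexity m + complexity n"
proof -
  obtain e where "expr_val e = m" "ones_count e = complexity m"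
    using complexity_expr[OF assms(1)] .
  moreover obtain f where "expr_val f = n" "ones_count f = complexity n"
    using complexity_expr[OF assms(2)] .
  ultimately show ?thesis using complexity_le[of "Times e f"] by simp
qed

lemma complexity_1 [simp]: "complexity (Suc 0) = 1"
  using complexity_le[of One] complexity_pos[of 1] by simp

text \<open>The cases are the last operation of an optimal expression. Its two subexpressions must
  be optimal too, since replacing one by a cheaper one would lower the total. A factor 1 is excluded
  because it would cost an extra 1.\<close>

lemma complexity_cases:
  assumes "n > 0"
  obtains (one) "n = 1"
  | (add) a b where "0 < b" "b \<le> a" "n = a + b" "complexity n = complexity a + complexity b"
  | (mult) u v where "1 < u" "1 < v" "n = u * v" "complexity n = complexity u + complexity v"
proof -
  obtain e where e: "expr_val e = n" "ones_count e = complexity n"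
    using complexity_expr[OF assms] .
  show ?thesis
  proof (cases e)
    case One
    then show ?thesis using e one by simp
  next
    case (Plus f g)
    define a b where "a = expr_val f" and "b = expr_val g"
    have ab: "a > 0" "b > 0" "n = a + b"
      using e Plus expr_val_pos by (auto simp: a_def b_def)
    have "complexity n = complexity a + complexity b"
      using e Plus complexity_le[of f] complexity_le[of g] complexity_add_le[OF ab(1,2)] ab(3)
      by (simp add: a_def b_def)
    then show ?thesis
      using ab add[of a b] add[of b a] by (cases "a \<le> b") (auto simp: add.commute)
  next
    case (Times f g)
    define u v where "u = expr_val f" and "v = expr_val g"
    have uv: "u > 0" "v > 0" "n = u * v"
      using e Times expr_val_pos by (auto simp: u_def v_def)
    have sum: "complexity n = complexity u + complexity v"
      using e Times complexity_le[of f] complexity_le[of g] complexity_mult_le[OF uv(1,2)] uv(3)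
      by (simp add: u_def v_def)
    have "u \<noteq> 1" "v \<noteq> 1"
      using sum uv by auto
    then show ?thesis using uv sum mult by (metis One_nat_def nat_neq_iff less_one)
  qed
qed

text \<open>Induction along one optimal expression: each step retains the equation between
  complexities, which is what lets defects be followed through sums and products.\<close>

lemma complexity_induct [consumes 1, case_names one add mult]:
  assumes "n > 0"
    and "P 1"
    and "\<And>a b. \<lbrakk>0 < b; b \<le> a; complexity (a + b) = complexity a + complexity b; P a; P b\<rbrakk>
           \<Longrightarrow> P (a + b)"
    and "\<And>u v. \<lbrakk>1 < u; 1 < v; complexity (u * v) = complexity u + complexity v; P u; P v\<rbrakk>
           \<Longrightarrow> P (u * v)"
  shows "P n"
  using assms(1)
proof (induction n rule: less_induct)
  case (less n)
  from less.prems show ?case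
  proof (cases rule: complexity_cases)
    case one
    then show ?thesis using assms(2) by simp
  next
    case (add a b)
    then show ?thesis using assms(3)[of b a] less.IH[of a] less.IH[of b] by simp
  next
    case (mult u v)
    then have "u < n" "v < n" by auto
    then show ?thesis using mult assms(4)[of u v] less.IH[of u] less.IH[of v] by simp
  qed
qed

lemma complexity_2: "complexity 2 = 2"
proof -
  have "(2::nat) > 0" by simp
  then show ?thesis
  proof (cases rule: complexity_cases)
    case (add a b)
    then have ab: "a = 1" "b = 1" by auto
    show ?thesis using add(4) unfolding ab by simp
  next
    case (mult u v)
    have "2 * 2 \<le> u * v" using mult(1,2) by (intro mult_le_mono) auto
    then show ?thesis using mult(3) by linarith
  qed simp
qed

lemma complexity_3: "complexity 3 = 3"
proof -
  have "(3::nat) > 0" by simp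
  then show ?thesis
  proof (cases rule: complexity_cases)
    case (add a b)
    then have ab: "a = 2" "b = 1" by auto
    show ?thesis using add(4) unfolding ab by (simp add: complexity_2)
  next
    case (mult u v)
    have "2 * 2 \<le> u * v" using mult(1,2) by (intro mult_le_mono) auto
    then show ?thesis using mult(3) by linarith
  qed simp
qed

lemma complexity_power3_mult_le:
  assumes "n > 0"
  shows "complexity (3 ^ k * n) \<le> 3 * k + complexity n"
proof (induction k)
  case (Suc k)
  have "complexity (3 * (3 ^ k * n)) \<le> 3 + complexity (3 ^ k * n)"
    using complexity_mult_le[of 3 "3 ^ k * n"] assms by (simp add: complexity_3)
  then show ?case using Suc by (simp add: mult.assoc)
qed simp


section \<open>Lower bounds for the defect\<close>

lemma defect_1: "defect 1 = 1"
  by (simp add: defect_def)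

lemma defect_2: "defect 2 = 2 - 3 * log 3 2"
  by (simp add: defect_def complexity_2)

lemma defect_3: "defect 3 = 0"
  by (simp add: defect_def complexity_3)

text \<open>These say 3 < 4 and 8 < 9; likewise the next estimate says 15 \<le> 16.\<close>

lemma log3_2_bounds: "1 / 2 < log 3 2" "log 3 2 < 2 / 3"
proof -
  have "1 < log 3 (2 ^ 2)" by (subst less_log_iff) auto
  then show "1 / 2 < log 3 2" using log_nat_power[of 2 3 2] by linarith
  have "log 3 8 < log 3 9" by (subst log_less_cancel_iff) auto
  moreover have "log 3 8 = 3 * log 3 2" "log 3 9 = 2"
    using log_nat_power[of 2 3 3] log_nat_power[of 3 3 2] by simp_all
  ultimately show "log 3 2 < 2 / 3" by linarith
qed

lemma log3_5_bound: "log 3 5 + 1 \<le> 4 * log 3 2"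
proof -
  have "log 3 5 + 1 = log 3 (5 * 3)" by (subst log_mult) auto
  also have "\<dots> \<le> log 3 (2 ^ 4)" by (subst log_le_cancel_iff) auto
  also have "\<dots> = 4 * log 3 2" using log_nat_power[of 2 3 4] by simp
  finally show ?thesis .
qed

lemma defect_2_bounds: "0 < defect 2" "2 * defect 2 \<le> 1"
  using log3_2_bounds by (auto simp: defect_2)

lemma defect_mult:
  assumes "u > 0" "v > 0" "complexity (u * v) = complexity u + complexity v"
  shows "defect (u * v) = defect u + defect v"
  using assms by (simp add: defect_def log_mult)

lemma log3_add:
  assumes "0 < a" "0 < b"
  shows "log 3 (real (a + b)) = log 3 (real a) + log 3 (1 + real b / real a)"
proof -
  have "real (a + b) = real a * (1 + real b / real a)"
    using assms by (simp add: field_simps)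
  moreover have "1 + real b / real a > 0" using assms by (simp add: add_pos_nonneg)
  ultimately show ?thesis using assms by (simp add: log_mult del: of_nat_add)
qed

text \<open>Adding \<open>b\<close> costs \<open>complexity b\<close> and gains only
  \<open>3 * log 3 (1 + b / a)\<close>, where \<open>b / a\<close> is at most 1. This settles
  \<open>b \<ge> 3\<close>; the smaller \<open>b\<close> are checked by hand. Equality holds at 4 =
  3 + 1 = 2 + 2.\<close>

lemma defect_sum_lower:
  assumes ab: "0 < b" "b \<le> a" "complexity (a + b) = complexity a + complexity b"
    and nonneg: "defect a \<ge> 0" "defect b \<ge> 0"
    and ne: "a + b \<noteq> 2" "a + b \<noteq> 3"
  shows "defect (a + b) \<ge> 2 * defect 2"
proof -
  have eq: "defect (a + b) = defect a + complexity b - 3 * log 3 (1 + real b / real a)"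
    using ab unfolding defect_def ab(3) by (subst log3_add) auto
  have mono: "log 3 (1 + real b / real a) \<le> log 3 x" if "1 + real b / real a \<le> x" for x
  proof -
    have "0 < 1 + real b / real a" by (simp add: add_pos_nonneg)
    then show ?thesis using that by simp
  qed
  note l2 = log3_2_bounds and l5 = log3_5_bound
  consider "b = 1" "a = 3" | "b = 1" "a \<ge> 4" | "b = 2" "a = 2" | "b = 2" "a \<ge> 3" | "b \<ge> 3"
    using ab ne by linarith
  then show ?thesis
  proof cases
    case 1
    have "log 3 (4 / 3) = 2 * log 3 2 - 1"
      using log_divide[of 3 4 3] log_nat_power[of 2 3 2] by simp
    then show ?thesis using eq 1 by (simp add: defect_3 defect_2)
  next
    case 2
    have "log 3 (5 / 4) = log 3 5 - 2 * log 3 2"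
      using log_divide[of 3 5 4] log_nat_power[of 2 3 2] by simp
    moreover have "1 + real b / real a \<le> 5 / 4" using 2 by (simp add: field_simps)
    ultimately show ?thesis using mono[of "5 / 4"] eq 2 nonneg l2 l5 by (simp add: defect_2)
  next
    case 3
    then show ?thesis using eq by (simp add: defect_2 complexity_2)
  next
    case 4
    have "log 3 (5 / 3) = log 3 5 - 1"
      using log_divide[of 3 5 3] by simp
    moreover have "1 + real b / real a \<le> 5 / 3" using 4 by (simp add: field_simps)
    ultimately show ?thesis using mono[of "5 / 3"] eq 4 nonneg l2 l5 by (simp add: defect_2 complexity_2)
  next
    case 5
    have "1 = log 3 3" by simp
    also have "\<dots> \<le> log 3 b" using 5 by (subst log_le_cancel_iff) auto
    finally have "complexity b \<ge> (3::real)" using nonneg(2) by (simp add: defect_def)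
    moreover have "1 + real b / real a \<le> 2" using ab by (simp add: field_simps)
    ultimately show ?thesis using mono[of 2] eq 5 nonneg l2 by (simp add: defect_2)
  qed
qed

text \<open>The least defect compatible with the residue of the complexity modulo 3; the three
  values are attained at 3, 2 and 4.\<close>

definition min_defect :: "nat \<Rightarrow> real" where
  "min_defect c = (if c mod 3 = 0 then 0 else if c mod 3 = 2 then defect 2 else 2 * defect 2)"

lemma min_defect_bounds: "0 \<le> min_defect c" "min_defect c \<le> 2 * defect 2"
  using defect_2_bounds by (auto simp: min_defect_def)

lemma min_defect_add: "min_defect (c + d) \<le> min_defect c + min_defect d"
proof -
  have "c mod 3 = 0 \<or> c mod 3 = 1 \<or> c mod 3 = 2" "d mod 3 = 0 \<or> d mod 3 = 1 \<or> d mod 3 = 2"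
    by presburger+
  moreover have "(c + d) mod 3 = (c mod 3 + d mod 3) mod 3" by presburger
  ultimately show ?thesis using defect_2_bounds(1) by (auto simp: min_defect_def)
qed

text \<open>For products this is subadditivity of \<open>min_defect\<close>. Sums other than 2 and 3
  already reach the largest of its three values, and at 2 and 3 equality holds.\<close>

lemma min_defect_le_defect: "n > 0 \<Longrightarrow> min_defect (complexity n) \<le> defect n"
proof (induction n rule: complexity_induct)
  case one
  then show ?case using defect_2_bounds by (simp add: min_defect_def defect_1[simplified])
next
  case (add a b)
  have nonneg: "defect a \<ge> 0" "defect b \<ge> 0"
    using add.IH min_defect_bounds(1) order.trans by blast+
  show ?case
  proof (cases "a + b = 2 \<or> a + b = 3")
    case True
    then show ?thesis
      by (auto simp: min_defect_def complexity_2 complexity_3 defect_3)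
  next
    case False
    then show ?thesis
      using defect_sum_lower[OF add.hyps nonneg] min_defect_bounds(2) order.trans by blast
  qed
next
  case (mult u v)
  then show ?case using defect_mult[of u v] min_defect_add[of "complexity u" "complexity v"] by simp
qed

lemma defect_nonneg: "n > 0 \<Longrightarrow> 0 \<le> defect n"
  using min_defect_le_defect min_defect_bounds(1) order.trans by blast


text \<open>Nonnegativity of the defect rules out complexity 3, because \<open>3 * log 3 4\<close>
  exceeds 3.\<close>

lemma defect_4: "complexity 4 = 4" "defect 4 = 2 * defect 2"
proof -
  have l4: "log 3 4 = 2 * log 3 2" using log_nat_power[of 2 3 2] by simp
  have "real (complexity 4) > 3"
    using defect_nonneg[of 4] l4 log3_2_bounds by (simp add: defect_def)
  moreover have "complexity 4 \<le> 4"
    using complexity_add_le[of 2 2] by (simp add: complexity_2)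
  ultimately show "complexity 4 = 4" by linarith
  then show "defect 4 = 2 * defect 2" using l4 by (simp add: defect_def complexity_2)
qed


section \<open>Descent\<close>

text \<open>Unfold the outer products of an optimal expression until only sums and ones remain. If
  no sum has a summand above \<open>A\<close>, every factor is at most \<open>2 * A\<close>. The
  bound \<open>defect 2\<close> on each listed factor later limits the length of the list.\<close>

lemma large_summand_or_bounded_factors:
  assumes "n > 0" "A > 0"
  shows "(\<exists>u a b. 0 < u \<and> A < a \<and> 0 < b \<and> b \<le> a \<and> n = u * (a + b) \<and>
            complexity (u * a) + complexity b \<le> complexity n)
       \<or> (\<exists>l. set l \<subseteq> {m \<in> {1..2 * A}. defect 2 \<le> defect m} \<and> defect n = sum_list (map defect l))"
    (is "?P n \<or> ?Q n")
  using assms(1)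
proof (induction n rule: complexity_induct)
  case one
  have "?Q 1"
    using assms(2) defect_2_bounds defect_1 by (intro exI[of _ "[1]"]) auto
  then show ?case by blast
next
  case (add a b)
  consider "A < a" | "a + b = 3" | "a \<le> A" "a + b \<noteq> 3" by linarith
  then show ?case
  proof cases
    case 1
    then have "?P (a + b)"
      using add.hyps by (intro exI[of _ 1] exI[of _ a] exI[of _ b]) auto
    then show ?thesis by blast
  next
    case 2
    \<comment> \<open>A factor 3 has defect 0 and is left out of the list, since arbitrarily many of
      them may occur.\<close>
    then have "?Q (a + b)" by (intro exI[of _ "[]"]) (simp add: defect_3)
    then show ?thesis by blast
  next
    case 3
    have "defect 2 \<le> defect (a + b)"
    proof (cases "a + b = 2")
      case False
      then show ?thesis
        using defect_sum_lower[OF add.hyps] defect_nonneg 3 add.hyps defect_2_bounds(1)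
        by (smt (verit) less_le_trans)
    qed simp
    then have "?Q (a + b)" using 3 add.hyps by (intro exI[of _ "[a + b]"]) auto
    then show ?thesis by blast
  qed
next
  case (mult u v)
  \<comment> \<open>The other factor \<open>y\<close> is absorbed into the outer multiplier.\<close>
  have step: "?P (x * y)" if "?P x" "y > 0" "complexity (x * y) = complexity x + complexity y" for x y
  proof -
    from that(1) obtain w a b where *: "0 < w" "A < a" "0 < b" "b \<le> a" "x = w * (a + b)"
      "complexity (w * a) + complexity b \<le> complexity x" by blast
    have "complexity (w * a * y) \<le> complexity (w * a) + complexity y"
      using * that(2) by (intro complexity_mult_le) auto
    then have "complexity (w * y * a) + complexity b \<le> complexity (x * y)"
      using * that(3) by (simp add: ac_simps)
    moreover have "x * y = (w * y) * (a + b)" using * by (simp add: ac_simps)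
    moreover have "0 < w * y" using * that(2) by simp
    ultimately show ?thesis using * by blast
  qed
  have "?P (u * v)" if "?P u" using step[OF that] mult.hyps by simp
  moreover have "?P (u * v)" if "?P v"
    using step[OF that, of u] mult.hyps by (simp add: mult.commute add.commute)
  moreover have "?Q (u * v)" if "?Q u" "?Q v"
  proof -
    from that obtain l l' where l: "set l \<subseteq> {m \<in> {1..2 * A}. defect 2 \<le> defect m}"
        "defect u = sum_list (map defect l)"
      and l': "set l' \<subseteq> {m \<in> {1..2 * A}. defect 2 \<le> defect m}"
        "defect v = sum_list (map defect l')"
      by blast
    have "defect (u * v) = sum_list (map defect (l @ l'))"
      using defect_mult[of u v] mult.hyps l l' by simp
    moreover have "set (l @ l') \<subseteq> {m \<in> {1..2 * A}. defect 2 \<le> defect m}"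
      using l(1) l'(1) by simp
    ultimately show ?thesis by blast
  qed
  ultimately show ?case using mult.IH by blast
qed

text \<open>If \<open>n = u * (a + b)\<close> is optimally written with \<open>a\<close> large, then dropping the bounded
  summand \<open>b\<close> gives \<open>m = u * a\<close>; this lowers the defect by almost exactly the integer
  \<open>j = complexity n - complexity m\<close>.\<close>

lemma defect_descent:
  fixes s e :: real
  assumes "e > 0"
  obtains F where "finite F"
    "\<And>n. \<lbrakk>n > 0; defect n \<le> s; defect n \<notin> F\<rbrakk> \<Longrightarrow> \<exists>m j x. m > 0 \<and> j > 0 \<and>
       complexity n = complexity m + j \<and> 0 < x \<and> x < e \<and> defect n = defect m + real j - x"
proof -
  \<comment> \<open>\<open>B\<close> will bound the summand \<open>b\<close>: its complexity is at
    most \<open>j\<close>, and \<open>j \<le> s + 2\<close>. The error \<open>x\<close> is below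
    \<open>e\<close> once \<open>1 + b / a < c\<close>, and \<open>A0\<close> is chosen so that
    \<open>a > A0\<close> and \<open>b \<le> B\<close> ensure this.\<close>
  define B where "B = 3 powr ((s + 2) / 3)"
  define c where "c = 3 powr (e / 3)"
  have "B > 0" by (simp add: B_def)
  have "c > 3 powr 0" unfolding c_def using assms by (intro powr_less_mono) auto
  then have "c > 1" by simp
  obtain A0 :: nat where A0: "B / (c - 1) < real A0" using reals_Archimedean2 by blast
  have "0 < B / (c - 1)" using \<open>B > 0\<close> \<open>c > 1\<close> by simp
  then have "A0 > 0" using A0 by (metis less_trans of_nat_0_less_iff)
  define G where "G = {m \<in> {1..2 * A0}. defect 2 \<le> defect m}"
  \<comment> \<open>A defect of at most \<open>s\<close> leaves room for at most \<open>N\<close>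
    factors of defect at least \<open>defect 2\<close>, so the bounded alternative yields only the
    finitely many values in \<open>F\<close>.\<close>
  define N where "N = nat \<lfloor>s / defect 2\<rfloor>"
  define F where "F = (\<lambda>l. sum_list (map defect l)) ` {l. set l \<subseteq> G \<and> length l \<le> N}"
  have "finite F"
    unfolding F_def by (intro finite_imageI finite_lists_length_le) (simp add: G_def)
  moreover have "\<exists>m j x. m > 0 \<and> j > 0 \<and> complexity n = complexity m + j \<and> 0 < x \<and> x < e \<and>
      defect n = defect m + real j - x"
    if n: "n > 0" "defect n \<le> s" "defect n \<notin> F" for n
  proof -
    have notQ: "defect n \<noteq> sum_list (map defect l)" if l: "set l \<subseteq> G" for l
    proof
      assume eq: "defect n = sum_list (map defect l)"
      have "real (length l) * defect 2 \<le> sum_list (map defect l)"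
        using l by (induction l) (auto simp: G_def algebra_simps)
      then have "real (length l) \<le> s / defect 2"
        using eq n(2) defect_2_bounds by (simp add: field_simps)
      then have "length l \<le> N" unfolding N_def by linarith
      then have "defect n \<in> F" unfolding F_def eq using l by blast
      then show False using n(3) by simp
    qed
    then obtain u a b where uab: "0 < u" "A0 < a" "0 < b" "b \<le> a" "n = u * (a + b)"
      "complexity (u * a) + complexity b \<le> complexity n"
      using large_summand_or_bounded_factors[OF n(1) \<open>A0 > 0\<close>] unfolding G_def by blast
    define j where "j = complexity n - complexity (u * a)"
    define x where "x = 3 * log 3 (1 + real b / real a)"
    have j: "complexity b \<le> j" "complexity n = complexity (u * a) + j"
      using uab by (auto simp: j_def)
    then have "j > 0" using complexity_pos[OF uab(3)] by linarith
    have log_n: "log 3 (real n) = log 3 (real (u * a)) + log 3 (1 + real b / real a)"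
      using uab log3_add[of a b] by (simp add: log_mult del: of_nat_add)
    have eq: "defect n = defect (u * a) + real j - x"
      using j(2) log_n by (simp add: defect_def x_def)
    have "1 + real b / real a > 1" using uab by simp
    then have "x > 0" by (simp add: x_def)
    have "1 + real b / real a \<le> 2" using uab by simp
    then have "log 3 (1 + real b / real a) \<le> log 3 2"
      using \<open>1 + real b / real a > 1\<close> by (subst log_le_cancel_iff) auto
    then have "x \<le> 2" using log3_2_bounds by (simp add: x_def)
    moreover have "defect (u * a) \<ge> 0" using uab by (intro defect_nonneg) auto
    ultimately have "real j \<le> s + 2" using eq n(2) by linarith
    then have "3 * log 3 (real b) \<le> s + 2"
      using j(1) defect_nonneg[OF uab(3)] by (simp add: defect_def)
    then have "real b \<le> B" unfolding B_def using uab(3) by (subst log_le_iff[symmetric]) auto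
    also have "B < real A0 * (c - 1)" using A0 \<open>c > 1\<close> by (simp add: field_simps)
    also have "\<dots> < real a * (c - 1)" using uab(2) \<open>c > 1\<close> by simp
    finally have "1 + real b / real a < c" using uab by (simp add: field_simps)
    then have "log 3 (1 + real b / real a) < e / 3"
      unfolding c_def using \<open>1 + real b / real a > 1\<close> by (subst log_less_iff) auto
    then have "x < e" by (simp add: x_def)
    then show ?thesis
      using eq j(2) \<open>j > 0\<close> \<open>x > 0\<close> uab
      by (intro exI[of _ "u * a"] exI[of _ j] exI[of _ x]) auto
  qed
  ultimately show ?thesis using that by blast
qed


section \<open>Limit points\<close>

text \<open>The set that contains the \<open>k\<close>-fold iterated limits of defects in class
  \<open>a\<close>. A shift by \<open>j\<close> counts as \<open>j\<close> further ones in the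
  residue condition.\<close>

definition shifted_defects :: "int \<Rightarrow> nat \<Rightarrow> real set" where
  "shifted_defects a k =
     {defect n + real j | n j. n > 0 \<and> k \<le> j \<and> [int (complexity n + j) = a] (mod 3)}"

lemma shifted_defects_antimono: "k \<le> l \<Longrightarrow> shifted_defects a l \<subseteq> shifted_defects a k"
  unfolding shifted_defects_def by (auto intro: order.trans)

lemma shifted_defects_ge: "shifted_defects a k \<subseteq> {real k..}"
proof
  fix z assume "z \<in> shifted_defects a k"
  then obtain n j where "z = defect n + real j" "n > 0" "k \<le> j"
    unfolding shifted_defects_def by blast
  then show "z \<in> {real k..}" using defect_nonneg[of n] by simp
qed

text \<open>Descent moves a point \<open>z\<close> near \<open>y\<close> by a small \<open>x\<close>
  to \<open>z + x\<close>, whose shift is larger by at least 1 and whose residue is the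
  same.\<close>

lemma limpt_shifted_defects_closure:
  assumes "y islimpt shifted_defects a k"
  shows "y \<in> closure (shifted_defects a (Suc k))"
  unfolding closure_approachable
proof (intro allI impI)
  fix e :: real assume "e > 0"
  then obtain F where F: "finite F"
    "\<And>n. \<lbrakk>n > 0; defect n \<le> y + 1; defect n \<notin> F\<rbrakk> \<Longrightarrow> \<exists>m j x. m > 0 \<and> j > 0 \<and>
       complexity n = complexity m + j \<and> 0 < x \<and> x < e / 2 \<and> defect n = defect m + real j - x"
    using defect_descent[of "e / 2" "y + 1"] by (metis half_gt_zero)
  \<comment> \<open>The points near \<open>y\<close> whose defect part is exceptional for the
    descent: finitely many, since nonnegative defects bound the shift by
    \<open>y + 1\<close>.\<close>
  define F' where "F' = (\<lambda>(f, j). f + real j) ` (F \<times> {..nat \<lceil>y + 1\<rceil>})"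
  have "finite F'" using F(1) by (simp add: F'_def)
  moreover have "infinite (shifted_defects a k \<inter> ball y (min 1 (e / 2)))"
    using assms \<open>e > 0\<close> by (simp add: islimpt_eq_infinite_ball)
  ultimately obtain z where z: "z \<in> shifted_defects a k" "z \<in> ball y (min 1 (e / 2))" "z \<notin> F'"
    by (metis IntE finite_subset subsetI)
  then obtain n i where n: "z = defect n + real i" "n > 0" "k \<le> i"
    "[int (complexity n + i) = a] (mod 3)"
    unfolding shifted_defects_def by blast
  have zy: "z < y + 1" "\<bar>z - y\<bar> < e / 2" using z(2) by (auto simp: dist_real_def abs_minus_commute)
  have "defect n \<le> y + 1" using n(1) zy by simp
  moreover have "i \<le> nat \<lceil>y + 1\<rceil>" using n(1) zy defect_nonneg[OF n(2)] by linarith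
  then have "defect n \<notin> F" using z(3) n(1) by (force simp: F'_def)
  ultimately obtain m j x where m: "m > 0" "j > 0" "complexity n = complexity m + j" "0 < x"
    "x < e / 2" "defect n = defect m + real j - x"
    using F(2) n(2) by blast
  have "z + x = defect m + real (j + i)" using m n by simp
  moreover have "[int (complexity m + (j + i)) = a] (mod 3)" using n m by (simp add: add.assoc)
  ultimately have "z + x \<in> shifted_defects a (Suc k)"
    unfolding shifted_defects_def using m n
    by (intro CollectI exI[of _ m] exI[of _ "j + i"]) auto
  moreover have "dist (z + x) y < e" using zy m(4,5) unfolding dist_real_def by linarith
  ultimately show "\<exists>z\<in>shifted_defects a (Suc k). dist z y < e" by blast
qed

text \<open>A point of the closure outside the set is again a limit point. If \<open>y\<close> were
  missing, it would thus be a limit point at every level, but level \<open>k + i\<close> lies above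
  \<open>k + i\<close>.\<close>

lemma limpt_shifted_defects:
  assumes "y islimpt shifted_defects a k"
  shows "y \<in> shifted_defects a (Suc k)"
proof (rule ccontr)
  assume notin: "y \<notin> shifted_defects a (Suc k)"
  have "y islimpt shifted_defects a (k + i)" for i
  proof (induction i)
    case (Suc i)
    then have "y \<in> closure (shifted_defects a (Suc (k + i)))"
      by (rule limpt_shifted_defects_closure)
    moreover have "y \<notin> shifted_defects a (Suc (k + i))"
      using notin shifted_defects_antimono[of "Suc k" "Suc (k + i)" a] by auto
    ultimately show ?case by (simp add: closure_def)
  qed (use assms in simp)
  then have "y \<in> closure (shifted_defects a (k + i))" for i
    by (simp add: closure_def)
  then have "real (k + i) \<le> y" for i
    using closure_minimal[OF shifted_defects_ge closed_atLeast] by (metis atLeast_iff subsetD)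
  moreover obtain i :: nat where "y < real i" using reals_Archimedean2 by blast
  ultimately show False by (smt (verit) le_add2 of_nat_mono)
qed

text \<open>Induction on an integer bound for \<open>y\<close>. A defect slightly above
  \<open>y\<close> descends to one slightly above \<open>y - j\<close>, because the error
  \<open>x\<close> is positive and small. Only finitely many \<open>j\<close> occur, so the gaps to
  the right of the points \<open>y - j\<close> have a common size.\<close>

lemma defect_right_isolated:
  obtains e where "e > 0" "\<And>n. n > 0 \<Longrightarrow> \<not> (y < defect n \<and> defect n < y + e)"
proof -
  have "\<exists>e>0. \<forall>n>0. \<not> (y < defect n \<and> defect n < y + e)" if "y < real m" for m y
    using that
  proof (induction m arbitrary: y)
    case 0
    have "\<not> (y < defect n \<and> defect n < y + (- y))" if "n > 0" for n
      using defect_nonneg[OF that] by linarith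
    then show ?case using 0 by (intro exI[of _ "- y"]) auto
  next
    case (Suc m)
    define M where "M = nat \<lceil>y + 3\<rceil>"
    have "\<exists>e>0. \<forall>n>0. \<not> (y - real j < defect n \<and> defect n < y - real j + e)" if "j > 0" for j :: nat
      using Suc.prems that by (intro Suc.IH) auto
    then obtain E :: "nat \<Rightarrow> real" where E: "\<And>j. j > 0 \<Longrightarrow> E j > 0"
      "\<And>j n. \<lbrakk>j > 0; n > 0\<rbrakk> \<Longrightarrow> \<not> (y - real j < defect n \<and> defect n < y - real j + E j)"
      by metis
    \<comment> \<open>The inserted 1 keeps the set nonempty and gives \<open>e0 \<le> 1\<close>,
      from which \<open>j \<le> M\<close> follows.\<close>
    define e0 where "e0 = Min (insert 1 (E ` {1..M}))"
    have "e0 > 0" unfolding e0_def using E(1) by (subst Min_gr_iff) auto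
    have e0_le: "e0 \<le> E j" if "j > 0" "j \<le> M" for j
      unfolding e0_def using that by (intro Min_le) auto
    obtain F where F: "finite F"
      "\<And>n. \<lbrakk>n > 0; defect n \<le> y + 1; defect n \<notin> F\<rbrakk> \<Longrightarrow> \<exists>m j x. m > 0 \<and> j > 0 \<and>
         complexity n = complexity m + j \<and> 0 < x \<and> x < e0 / 2 \<and> defect n = defect m + real j - x"
      using defect_descent[of "e0 / 2" "y + 1"] \<open>e0 > 0\<close> by (metis half_gt_zero)
    obtain d where d: "d > 0" "\<And>x. x \<in> F \<Longrightarrow> x \<noteq> y \<Longrightarrow> d \<le> dist y x"
      using finite_set_avoid[OF F(1), of y] by auto
    define e where "e = min d (min 1 (e0 / 2))"
    have "\<not> (y < defect n \<and> defect n < y + e)" if pos: "n > 0" for n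
    proof
      assume n: "y < defect n \<and> defect n < y + e"
      then have "defect n \<notin> F" using d(2)[of "defect n"] by (auto simp: dist_real_def e_def)
      moreover have "defect n \<le> y + 1" using n unfolding e_def by linarith
      ultimately obtain m j x where m: "m > 0" "j > 0" "0 < x" "x < e0 / 2"
        "defect n = defect m + real j - x"
        using F(2)[OF pos] by blast
      have "e \<le> e0 / 2" by (simp add: e_def)
      have "e0 \<le> 1" unfolding e0_def by (intro Min_le) auto
      then have "real j \<le> y + 3"
        using m(4,5) n defect_nonneg[OF m(1)] \<open>e \<le> e0 / 2\<close> by linarith
      then have "j \<le> M" unfolding M_def by linarith
      then have "e0 \<le> E j" by (rule e0_le[OF m(2)])
      moreover have "y - real j < defect m" using m(3,5) n by linarith
      ultimately have "\<not> defect m < y - real j + e0" using E(2)[OF m(2,1)] by linarith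
      then show False using m(4,5) n \<open>e \<le> e0 / 2\<close> by linarith
    qed
    moreover have "e > 0" using d(1) \<open>e0 > 0\<close> by (simp add: e_def)
    ultimately show ?case by blast
  qed
  moreover obtain m :: nat where "y < real m" using reals_Archimedean2 by blast
  ultimately show ?thesis using that by blast
qed

text \<open>The gap to the right of the infimum forces it to be attained; this is the well-ordering
  of the defects.\<close>

lemma defects_least:
  assumes "T \<subseteq> {defect n | n. n > 0}" "T \<noteq> {}"
  shows "\<exists>t\<in>T. \<forall>t'\<in>T. t \<le> t'"
proof -
  obtain e where e: "e > 0" "\<And>n. n > 0 \<Longrightarrow> \<not> (Inf T < defect n \<and> defect n < Inf T + e)"
    using defect_right_isolated[of "Inf T"] by blast
  have bdd: "bdd_below T"
    using assms(1) defect_nonneg by (intro bdd_belowI[of _ 0]) auto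
  have "Inf T < Inf T + e" using e(1) by simp
  then obtain t where t: "t \<in> T" "t < Inf T + e" using cInf_lessD[OF assms(2)] by blast
  obtain n where n: "t = defect n" "n > 0" using t(1) assms(1) by blast
  have "t \<le> Inf T" using e(2)[OF n(2)] t(2) unfolding n(1) by linarith
  moreover have "Inf T \<le> t'" if "t' \<in> T" for t' using that bdd by (rule cInf_lower)
  ultimately show ?thesis using t(1) order.trans by blast
qed


section \<open>Thresholds\<close>

text \<open>The equation makes \<open>3 * log 3 (n / m)\<close> the difference of
  \<open>complexity n\<close> and \<open>complexity m + j\<close>. This is a multiple of 3 by the
  congruence, so one of \<open>n\<close>, \<open>m\<close> is a power of 3 times the other.\<close>

lemma defects_differing_by_nat:
  assumes "n > 0" "m > 0" "defect n = defect m + real j"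
    "[int (complexity n) = int (complexity m + j)] (mod 3)"
  shows "(\<exists>i. n = 3 ^ i * m \<and> complexity n = complexity m + j + 3 * i) \<or>
         (\<exists>i. m = 3 ^ i * n \<and> complexity m + j = complexity n + 3 * i)"
proof -
  have power: "u = 3 ^ i * v" if "u > 0" "v > 0" "log 3 (real u) = log 3 (real v) + real i" for u v i :: nat
  proof -
    have "log 3 (real u) = log 3 (real (3 ^ i * v))"
      using that by (simp add: log_mult log_nat_power)
    then have "real u = real (3 ^ i * v)"
      using that by (subst (asm) log_inj[THEN inj_on_eq_iff]) auto
    then show ?thesis by (simp only: of_nat_eq_iff)
  qed
  have eq: "3 * log 3 (real n) = 3 * log 3 (real m) + real (complexity n) - real (complexity m + j)"
    using assms(3) by (simp add: defect_def)
  have "[int (complexity n) = int (complexity m + j)] (mod int 3)"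
    using assms(4) by (simp only: of_nat_numeral)
  then have cong: "[complexity n = complexity m + j] (mod 3)" unfolding cong_int_iff .
  show ?thesis
  proof (cases "complexity m + j \<le> complexity n")
    case True
    then obtain i where "complexity n = i * 3 + (complexity m + j)"
      using cong cong_le_nat by blast
    then have i: "complexity n = complexity m + j + 3 * i" by simp
    then have "log 3 (real n) = log 3 (real m) + real i" using eq by simp
    then show ?thesis using power assms i by blast
  next
    case False
    then obtain i where "complexity m + j = i * 3 + complexity n"
      using cong cong_sym cong_le_nat nat_le_linear by blast
    then have i: "complexity m + j = complexity n + 3 * i" by simp
    then have "real (complexity m + j) = real (complexity n) + 3 * real i" by simp
    then have "log 3 (real m) = log 3 (real n) + real i" using eq by simp
    then show ?thesis using power assms i by blast
  qed
qed

text \<open>The case names are the residue of \<open>a - k\<close>, that is, the residue which the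
  complexity of an unshifted number must have.\<close>

lemma threshold_cases:
  obtains (0) "[int k = a] (mod 3)" "threshold a k = real k"
  | (1) "[int k + 1 = a] (mod 3)" "threshold a k = real k + 2 * defect 2"
  | (2) "[int k + 2 = a] (mod 3)" "threshold a k = real k + defect 2"
proof -
  define q r where "q = (a - int k) div 3" and "r = (a - int k) mod 3"
  have a: "a = int k + (3 * q + r)" unfolding q_def r_def by simp
  have "0 \<le> r" "r < 3" unfolding r_def by simp_all
  then consider "r = 0" | "r = 1" | "r = 2" by linarith
  moreover have "[int k + i = a] (mod 3) \<longleftrightarrow> 3 dvd i - r" for i
    using dvd_add_right_iff[of 3 "- (3 * q)" "i - r"] unfolding a cong_iff_dvd_diff
    by (simp add: algebra_simps)
  note cong = this
  have "[int k = a] (mod 3) \<longleftrightarrow> 3 dvd r" "[int k = a + 1] (mod 3) \<longleftrightarrow> 3 dvd r + 1"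
    using cong[of 0] cong[of "- 1"] dvd_minus_iff[of 3 "r + 1"] unfolding cong_iff_dvd_diff
    by (simp_all add: algebra_simps)
  ultimately show ?thesis
    using that cong[of 1] cong[of 2] by cases (simp_all add: threshold_def)
qed

text \<open>The numbers 3, 4 and 2 have complexities of residue 0, 1 and 2 and the least defect in
  each.\<close>

lemma threshold_eq_defect:
  obtains n where "n \<in> {2, 3, 4}" "threshold a k = defect n + real k"
    "[int (complexity n + k) = a] (mod 3)"
proof (cases a k rule: threshold_cases)
  case 0
  have "[3 + int k = 0 + int k] (mod 3)" by (intro cong_add) (simp_all add: cong_def)
  then show ?thesis
    using that[of 3] 0 cong_trans[of "3 + int k" "int k" 3 a] by (simp add: defect_3 complexity_3)
next
  case 1
  have "[4 + int k = 1 + int k] (mod 3)" by (intro cong_add) (simp_all add: cong_def)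
  then show ?thesis
    using that[of 4] 1 cong_trans[of "4 + int k" "1 + int k" 3 a] by (simp add: defect_4 add.commute)
next
  case 2
  then show ?thesis
    using that[of 2] by (simp add: complexity_2 add.commute)
qed

lemma threshold_bounds: "0 \<le> threshold a k" "threshold a k \<le> real k + 2 * defect 2"
  using defect_2_bounds by (auto simp: threshold_def)

text \<open>With shift exactly \<open>k\<close>, the residue of the complexity is fixed and
  \<open>min_defect\<close> gives the bound. A larger shift suffices by itself because
  \<open>2 * defect 2 \<le> 1\<close>.\<close>

lemma threshold_le_shifted_defects:
  assumes "z \<in> shifted_defects a k"
  shows "threshold a k \<le> z"
proof -
  obtain n j where n: "z = defect n + real j" "n > 0" "k \<le> j" "[int (complexity n + j) = a] (mod 3)"
    using assms unfolding shifted_defects_def by blast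
  show ?thesis
  proof (cases "j = k")
    case True
    have residue: "complexity n mod 3 = i" if "[int k + int i = a] (mod 3)" "i < 3" for i
    proof -
      have "[int k + int (complexity n) = int k + int i] (mod 3)"
        using n(4) True cong_sym[OF that(1)] by (auto intro: cong_trans simp: add.commute)
      then have "[int (complexity n) = int i] (mod int 3)" by (simp add: cong_add_lcancel)
      then have "[complexity n = i] (mod 3)" unfolding cong_int_iff .
      then show ?thesis using that(2) by (simp add: cong_def)
    qed
    have "threshold a k \<le> real k + min_defect (complexity n)"
      using residue[of 1] residue[of 2] min_defect_bounds(1)
      by (cases a k rule: threshold_cases) (auto simp: min_defect_def)
    then show ?thesis using min_defect_le_defect[OF n(2)] n(1) True by simp
  next
    case False
    then have "real k + 1 \<le> real j" using n(3) by simp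
    then show ?thesis
      using n(1) defect_nonneg[OF n(2)] threshold_bounds(2)[of a k] defect_2_bounds by linarith
  qed
qed

text \<open>This keeps the closed right end of the interval from adding a last point. A number with
  this defect would differ from \<open>m\<close> by a power of 3, and comparing complexities then
  gives a contradiction.\<close>

lemma threshold_notin_defects_class:
  assumes "k > 0"
  shows "threshold a k \<notin> defects_class a"
proof
  assume "threshold a k \<in> defects_class a"
  then obtain n where n: "threshold a k = defect n" "n > 0" "n \<noteq> 1"
    "[int (complexity n) = a] (mod 3)"
    unfolding defects_class_def by blast
  obtain m where m: "m \<in> {2, 3, 4}" "threshold a k = defect m + real k"
    "[int (complexity m + k) = a] (mod 3)"
    by (rule threshold_eq_defect)
  have "(\<exists>i. n = 3 ^ i * m \<and> complexity n = complexity m + k + 3 * i) \<or>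
        (\<exists>i. m = 3 ^ i * n \<and> complexity m + k = complexity n + 3 * i)"
    using n(2) m(1) n(1)[symmetric] m(2) cong_trans[OF n(4) cong_sym[OF m(3)]]
    by (intro defects_differing_by_nat) auto
  then show False
  proof (elim disjE exE conjE)
    fix i assume "n = 3 ^ i * m" "complexity n = complexity m + k + 3 * i"
    then show False using complexity_power3_mult_le[of m i] m(1) assms by auto
  next
    fix i assume i: "m = 3 ^ i * n" "complexity m + k = complexity n + 3 * i"
    \<comment> \<open>Otherwise \<open>m = 3\<close> and \<open>n = 1\<close>. The exclusion of 1
      from \<open>defects_class\<close> matters here: \<open>defect 1 = 1\<close> is the threshold
      for \<open>k = 1\<close>, \<open>a = 1\<close>.\<close>
    have "i = 0"
    proof (rule ccontr)
      assume "i \<noteq> 0"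
      then obtain i' where "i = Suc i'" by (cases i) auto
      then have "m = 3 * (3 ^ i' * n)" using i by (simp add: mult.assoc)
      moreover from this have "3 dvd m" by simp
      then have "m = 3" using m(1) by auto
      ultimately have "3 ^ i' * n = 1" by simp
      then show False using n(3) by simp
    qed
    then show False using i assms by simp
  qed
qed


section \<open>Stable numbers\<close>

lemma stable_neq_1:
  assumes "stable n"
  shows "n \<noteq> 1"
proof
  assume "n = 1"
  then have "complexity (3 ^ 1 * 1) = 3 * 1 + complexity 1"
    using assms unfolding stable_def by blast
  then show False by (simp add: complexity_3)
qed

text \<open>Failing stability would lower the defect by a positive integer, hence below 0.\<close>

lemma stable_if_defect_less_1:
  assumes "n > 0" "defect n < 1"
  shows "stable n"
  unfolding stable_def
proof (intro conjI allI)
  fix k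
  have "3 * log 3 (real (3 ^ k * n)) = 3 * real k + 3 * log 3 (real n)"
    using assms by (simp add: log_mult log_nat_power)
  moreover have "defect (3 ^ k * n) \<ge> 0" using assms by (intro defect_nonneg) auto
  ultimately have "real (complexity (3 ^ k * n)) > 3 * real k + real (complexity n) - 1"
    using assms(2) by (simp add: defect_def)
  then have "complexity (3 ^ k * n) \<ge> 3 * k + complexity n" by linarith
  then show "complexity (3 ^ k * n) = 3 * k + complexity n"
    using complexity_power3_mult_le[OF assms(1), of k] by linarith
qed (fact assms)

text \<open>The two numbers would differ by a power of 3. Either way the positive shift contradicts
  the bound for \<open>3 ^ i * m\<close> or the stability of \<open>n\<close>.\<close>

lemma stable_defect_notin_shifted:
  assumes "stable n"
  shows "defect n \<notin> shifted_defects (int (complexity n)) 1"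
proof
  assume "defect n \<in> shifted_defects (int (complexity n)) 1"
  then obtain m j where m: "defect n = defect m + real j" "m > 0" "1 \<le> j"
    "[int (complexity m + j) = int (complexity n)] (mod 3)"
    unfolding shifted_defects_def by blast
  have n: "n > 0" "\<And>k. complexity (3 ^ k * n) = 3 * k + complexity n"
    using assms by (auto simp: stable_def)
  from defects_differing_by_nat[OF n(1) m(2,1) cong_sym[OF m(4)]]
  show False
  proof (elim disjE exE conjE)
    fix i assume "n = 3 ^ i * m" "complexity n = complexity m + j + 3 * i"
    then show False using complexity_power3_mult_le[OF m(2), of i] m(3) by simp
  next
    fix i assume "m = 3 ^ i * n" "complexity m + j = complexity n + 3 * i"
    then show False using n(2)[of i] m(3) by simp
  qed
qed

text \<open>The defect that \<open>3 ^ e * n + 1\<close> has when its evident representation, with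
  \<open>3 * e + complexity n + 1\<close> ones, is optimal.\<close>

definition succ_defect :: "nat \<Rightarrow> nat \<Rightarrow> real" where
  "succ_defect n e = defect n + 1 - 3 * log 3 (1 + 1 / real (3 ^ e * n))"

lemma succ_defect_less: "n > 0 \<Longrightarrow> succ_defect n e < defect n + 1"
  unfolding succ_defect_def using zero_less_log_cancel_iff[of 3 "1 + 1 / real (3 ^ e * n)"]
  by (simp add: add_pos_pos)

lemma succ_defect_strict_mono:
  assumes "n > 0" "e < e'"
  shows "succ_defect n e < succ_defect n e'"
proof -
  have "real (3 ^ e * n) < real (3 ^ e' * n)"
    using assms by (simp only: of_nat_less_iff) simp
  moreover have "real (3 ^ e * n) > 0" using assms by simp
  ultimately have "1 + 1 / real (3 ^ e' * n) < 1 + 1 / real (3 ^ e * n)"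
    by (intro add_strict_left_mono divide_strict_left_mono) auto
  moreover have "0 < 1 + 1 / real (3 ^ e' * n)" using assms by (simp add: add_pos_nonneg)
  ultimately show ?thesis unfolding succ_defect_def by (subst diff_strict_left_mono) auto
qed

lemma succ_defect_tendsto:
  assumes "n > 0"
  shows "succ_defect n \<longlonglongrightarrow> defect n + 1"
proof -
  have "(\<lambda>e. inverse (real n) * inverse (3 ^ e)) \<longlonglongrightarrow> inverse (real n) * 0"
    by (intro tendsto_mult tendsto_const LIMSEQ_inverse_realpow_zero) simp
  then have "(\<lambda>e. 1 / real (3 ^ e * n)) \<longlonglongrightarrow> 0" by (simp add: field_simps)
  then have "(\<lambda>e. defect n + 1 - 3 * log 3 (1 + 1 / real (3 ^ e * n)))
      \<longlonglongrightarrow> defect n + 1 - 3 * log 3 (1 + 0)"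
    by (intro tendsto_diff tendsto_mult tendsto_log tendsto_add tendsto_const) auto
  then show ?thesis by (simp add: succ_defect_def[abs_def])
qed

lemma succ_defect_eq:
  assumes "n > 0"
  shows "succ_defect n e = real (3 * e + complexity n + 1) - 3 * log 3 (real (3 ^ e * n + 1))"
proof -
  have "log 3 (real (3 ^ e * n + 1)) = log 3 (real (3 ^ e * n)) + log 3 (1 + 1 / real (3 ^ e * n))"
    using log3_add[of "3 ^ e * n" 1] assms by simp
  moreover have "log 3 (real (3 ^ e * n)) = real e + log 3 (real n)"
    using assms by (simp add: log_mult log_nat_power)
  ultimately show ?thesis by (simp add: succ_defect_def defect_def)
qed

text \<open>If this failed for infinitely many exponents, then \<open>defect n + 1\<close> would be a limit point
  of the shifted defects, which forces \<open>defect n\<close> to be a defect plus a positive integer.\<close>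

lemma stable_succ:
  assumes "stable n"
  obtains E where "\<And>e. E \<le> e \<Longrightarrow> stable (3 ^ e * n + 1)"
    "\<And>e. E \<le> e \<Longrightarrow> complexity (3 ^ e * n + 1) = 3 * e + complexity n + 1"
proof -
  let ?bad = "\<lambda>e. \<not> (stable (3 ^ e * n + 1) \<and> complexity (3 ^ e * n + 1) = 3 * e + complexity n + 1)"
  let ?S = "shifted_defects (int (complexity n) + 1) 1"
  have n: "n > 0" using assms by (simp add: stable_def)
  have bad: "succ_defect n e \<in> ?S" if "?bad e" for e
  proof -
    define N where "N = 3 ^ e * n + 1"
    have "N > 0" by (simp add: N_def)
    have le: "complexity (3 ^ i * N) \<le> 3 * i + (3 * e + complexity n + 1)" for i
    proof -
      have "complexity N \<le> 3 * e + complexity n + 1"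
        using complexity_add_le[of "3 ^ e * n" 1] complexity_power3_mult_le[OF n, of e] n
        by (simp add: N_def)
      then show ?thesis using complexity_power3_mult_le[OF \<open>N > 0\<close>, of i] by linarith
    qed
    \<comment> \<open>Equality for all \<open>i\<close> would give the complexity of
      \<open>N\<close> at \<open>i = 0\<close> and then its stability. The \<open>d\<close> ones
      saved at some \<open>i\<close> become the shift.\<close>
    have "\<exists>i. complexity (3 ^ i * N) \<noteq> 3 * i + (3 * e + complexity n + 1)"
    proof (rule ccontr)
      assume "\<nexists>i. complexity (3 ^ i * N) \<noteq> 3 * i + (3 * e + complexity n + 1)"
      then have *: "complexity (3 ^ i * N) = 3 * i + (3 * e + complexity n + 1)" for i by blast
      then show False
        using that *[of 0] \<open>N > 0\<close> unfolding stable_def N_def[symmetric] by auto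
    qed
    then obtain i where "complexity (3 ^ i * N) < 3 * i + (3 * e + complexity n + 1)"
      using le by (meson le_neq_implies_less)
    then obtain d where d: "3 * i + (3 * e + complexity n + 1) = complexity (3 ^ i * N) + d" "d > 0"
      by (metis less_imp_add_positive)
    have "log 3 (real (3 ^ i * N)) = real i + log 3 (real N)"
      using \<open>N > 0\<close> by (simp add: log_mult log_nat_power)
    moreover have "real (3 * i + (3 * e + complexity n + 1)) = real (complexity (3 ^ i * N) + d)"
      using d(1) by (rule arg_cong)
    ultimately have "succ_defect n e = defect (3 ^ i * N) + real d"
      unfolding succ_defect_eq[OF n] defect_def N_def[symmetric] by simp
    moreover have "[int (complexity (3 ^ i * N) + d) = int (complexity n) + 1] (mod 3)"
      unfolding d(1)[symmetric] cong_iff_dvd_diff by simp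
    moreover have "3 ^ i * N > 0" using \<open>N > 0\<close> by simp
    ultimately show ?thesis unfolding shifted_defects_def using d(2)
      by (intro CollectI exI[of _ "3 ^ i * N"] exI[of _ d]) simp
  qed
  have "\<exists>E. \<forall>e\<ge>E. \<not> ?bad e"
  proof (rule ccontr)
    assume frequently: "\<nexists>E. \<forall>e\<ge>E. \<not> ?bad e"
    have "defect n + 1 islimpt ?S"
      unfolding islimpt_approachable
    proof (intro allI impI)
      fix r :: real assume "r > 0"
      then obtain E where "\<And>e. e \<ge> E \<Longrightarrow> dist (succ_defect n e) (defect n + 1) < r"
        using succ_defect_tendsto[OF n] unfolding lim_sequentially by blast
      moreover obtain e where "e \<ge> E" "?bad e" using frequently by blast
      ultimately show "\<exists>x\<in>?S. x \<noteq> defect n + 1 \<and> dist x (defect n + 1) < r"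
        using bad succ_defect_less[OF n] by (metis less_irrefl)
    qed
    then have "defect n + 1 \<in> shifted_defects (int (complexity n) + 1) (Suc 1)"
      by (rule limpt_shifted_defects)
    then obtain m j where m: "defect n + 1 = defect m + real j" "m > 0" "Suc 1 \<le> j"
      "[int (complexity m + j) = int (complexity n) + 1] (mod 3)"
      unfolding shifted_defects_def by blast
    \<comment> \<open>The limit has shift at least 2, so cancelling the added 1 still leaves a
      positive shift for \<open>defect n\<close>.\<close>
    then obtain j' where j': "j = Suc j'" "1 \<le> j'" by (cases j) auto
    have "[int (complexity m + j') + 1 = int (complexity n) + 1] (mod 3)"
      using m(4) j'(1) by (simp add: ac_simps)
    then have "[int (complexity m + j') = int (complexity n)] (mod 3)"
      by (simp only: cong_add_rcancel)
    then have "defect n \<in> shifted_defects (int (complexity n)) 1"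
      unfolding shifted_defects_def using m j' by (intro CollectI exI[of _ m] exI[of _ j']) simp
    then show False using stable_defect_notin_shifted[OF assms] by simp
  qed
  then show ?thesis using that by blast
qed


section \<open>Order types\<close>

text \<open>Thus \<open>omega_pow k\<close> is the lexicographic order on lists of length
  \<open>k\<close>, with the head most significant.\<close>

lemma omega_pow_Cons:
  "(n # xs, m # ys) \<in> omega_pow (Suc k) \<longleftrightarrow>
     length xs = k \<and> length ys = k \<and> (n < m \<or> n = m \<and> (xs, ys) \<in> omega_pow k)"
proof -
  have "(n # xs, m # ys) \<in> omega_pow (Suc k) \<longleftrightarrow>
      ((xs, n), (ys, m)) \<in> ord_prod (omega_pow k) natLeq"
    by (auto simp: dir_image_def)
  moreover have "(i, j) \<in> natLeq \<longleftrightarrow> i \<le> j" for i j by (simp add: natLeq_def)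
  ultimately show ?thesis
    by (auto simp: ord_prod_def Field_omega_pow Field_natLeq simp del: omega_pow.simps)
qed

definition omega_pow_strict_mono :: "nat \<Rightarrow> (nat list \<Rightarrow> real) \<Rightarrow> bool" where
  "omega_pow_strict_mono k f \<longleftrightarrow> (\<forall>xs ys. (xs, ys) \<in> omega_pow k \<and> xs \<noteq> ys \<longrightarrow> f xs < f ys)"

lemma omega_pow_strict_mono_Cons:
  assumes "omega_pow_strict_mono (Suc k) f"
  shows "omega_pow_strict_mono k (\<lambda>xs. f (n # xs))"
    and "\<lbrakk>n < m; length xs = k; length ys = k\<rbrakk> \<Longrightarrow> f (n # xs) < f (m # ys)"
proof -
  have len: "length xs = k \<and> length ys = k" if "(xs, ys) \<in> omega_pow k" for xs ys
    using that FieldI1 FieldI2 Field_omega_pow by fastforce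
  show "omega_pow_strict_mono k (\<lambda>xs. f (n # xs))"
    unfolding omega_pow_strict_mono_def
  proof (intro allI impI, elim conjE)
    fix xs ys assume *: "(xs, ys) \<in> omega_pow k" "xs \<noteq> ys"
    then have "(n # xs, n # ys) \<in> omega_pow (Suc k)"
      unfolding omega_pow_Cons using len by blast
    then show "f (n # xs) < f (n # ys)"
      using assms * unfolding omega_pow_strict_mono_def by blast
  qed
  assume *: "n < m" "length xs = k" "length ys = k"
  then have "(n # xs, m # ys) \<in> omega_pow (Suc k)" unfolding omega_pow_Cons by blast
  then show "f (n # xs) < f (m # ys)"
    using assms * unfolding omega_pow_strict_mono_def by blast
qed

text \<open>Fixing the head splits the copy of \<omega>^(k+1) into blocks of type \<omega>^k. Their
  suprema lie in level \<open>k\<close> by induction and approach the total supremum without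
  reaching it, so that supremum is a limit point and lies one level higher.\<close>

lemma Sup_in_shifted_defects:
  assumes "omega_pow_strict_mono k f"
    and "\<And>xs. length xs = k \<Longrightarrow> f xs \<in> shifted_defects a 0"
    and "\<And>xs. length xs = k \<Longrightarrow> f xs \<le> s"
  shows "Sup (f ` {xs. length xs = k}) \<in> shifted_defects a k"
  using assms
proof (induction k arbitrary: f)
  case 0
  have "{xs :: nat list. length xs = 0} = {[]}" by auto
  then show ?case using 0 by simp
next
  case (Suc k)
  define Y where "Y = Sup (f ` {xs. length xs = Suc k})"
  define y where "y n = Sup ((\<lambda>xs. f (n # xs)) ` {xs. length xs = k})" for n
  define z :: "nat list" where "z = replicate k 0"
  have z: "length z = k" by (simp add: z_def)
  have y: "y n \<in> shifted_defects a k" for n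
    unfolding y_def using Suc.prems
    by (intro Suc.IH omega_pow_strict_mono_Cons(1)) auto
  have bdd: "bdd_above (f ` {xs. length xs = Suc k})"
    using Suc.prems(3) by (intro bdd_aboveI[of _ s]) auto
  have bdd_n: "bdd_above ((\<lambda>xs. f (n # xs)) ` {xs. length xs = k})" for n
    using Suc.prems(3) by (intro bdd_aboveI[of _ s]) auto
  \<comment> \<open>The next block bounds \<open>y n\<close> only weakly; strictness comes from
    going one block further.\<close>
  have y_less: "y n < Y" for n
  proof -
    have "y n \<le> f (Suc n # z)"
      unfolding y_def
      using z omega_pow_strict_mono_Cons(2)[OF Suc.prems(1), of n "Suc n" _ z]
      by (intro cSup_least) (auto intro: less_imp_le)
    also have "\<dots> < f (Suc (Suc n) # z)"
      using z by (intro omega_pow_strict_mono_Cons(2)[OF Suc.prems(1)]) auto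
    also have "\<dots> \<le> Y" unfolding Y_def using z bdd by (intro cSup_upper) auto
    finally show ?thesis .
  qed
  have "Y islimpt shifted_defects a k"
    unfolding islimpt_approachable
  proof (intro allI impI)
    fix e :: real assume "e > 0"
    then have "Y - e < Y" by simp
    moreover have "f ` {xs. length xs = Suc k} \<noteq> {}" using z by (auto simp: length_Suc_conv)
    ultimately obtain t where "t \<in> f ` {xs. length xs = Suc k}" "Y - e < t"
      unfolding Y_def by (meson less_cSupD)
    then obtain ys where ys: "length ys = Suc k" "Y - e < f ys" by blast
    then obtain n xs where nxs: "ys = n # xs" "length xs = k" by (auto simp: length_Suc_conv)
    have "f ys \<le> y n"
      unfolding y_def nxs(1) using nxs bdd_n by (intro cSup_upper) auto
    then have "dist (y n) Y < e" using y_less[of n] ys by (simp add: dist_real_def)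
    then show "\<exists>x'\<in>shifted_defects a k. x' \<noteq> Y \<and> dist x' Y < e"
      using y y_less by (metis less_irrefl)
  qed
  then show ?case unfolding Y_def by (rule limpt_shifted_defects)
qed

text \<open>The supremum of the copy is at least the threshold, hence equal to both it and
  \<open>x\<close>. For \<open>k > 0\<close> the threshold is not in the class; for
  \<open>k = 0\<close> the supremum is a value of \<open>f\<close>, which is below
  \<open>x\<close>.\<close>

lemma no_omega_pow_below_defect:
  assumes f: "omega_pow_strict_mono k f" "\<And>xs. length xs = k \<Longrightarrow> f xs \<in> defects_class a"
    and x: "x \<in> defects_class a" "x \<le> threshold a k"
    and less: "\<And>xs. length xs = k \<Longrightarrow> f xs < x"
  shows False
proof -
  define Y where "Y = Sup (f ` {xs. length xs = k})"
  have "defects_class a \<subseteq> shifted_defects a 0"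
    unfolding defects_class_def shifted_defects_def by force
  then have "Y \<in> shifted_defects a k"
    unfolding Y_def using f less by (intro Sup_in_shifted_defects[of _ _ _ x]) (auto intro: less_imp_le)
  then have "threshold a k \<le> Y" by (rule threshold_le_shifted_defects)
  moreover have "length (replicate k (0::nat)) = k" by simp
  then have "f ` {xs. length xs = k} \<noteq> {}" by blast
  then have "Y \<le> x" unfolding Y_def using less by (intro cSup_least) (auto intro: less_imp_le)
  ultimately have "x = threshold a k" "Y = x" using x(2) by auto
  then have "k = 0" using threshold_notin_defects_class x(1) by blast
  then have "Y = f []" unfolding Y_def by simp
  then show False using less[of "[]"] \<open>Y = x\<close> \<open>k = 0\<close> by simp
qed

section \<open>Copies of \<omega>^k among the stable defects\<close>

lemma stable_defects_class_cong:
  assumes "[a = b] (mod 3)"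
  shows "stable_defects_class a = stable_defects_class b"
  using assms unfolding stable_defects_class_def defects_class_def cong_def by simp

text \<open>For \<open>Suc k\<close>, concatenate copies of \<omega>^k built from the stable numbers
  \<open>c i = 3 ^ e i * n + 1\<close>. The lower bound \<open>v\<close> is carried through the
  induction so that each block can be placed above the preceding one.\<close>

lemma omega_pow_of_stable_defects:
  assumes "stable n" "v < defect n + real k"
  shows "\<exists>f. omega_pow_strict_mono k f \<and>
    (\<forall>xs. length xs = k \<longrightarrow> f xs \<in> stable_defects_class (int (complexity n + k)) \<and>
       v < f xs \<and> f xs \<le> defect n + real k)"
  using assms
proof (induction k arbitrary: n v)
  case 0
  have "omega_pow_strict_mono 0 (\<lambda>xs. defect n)" by (simp add: omega_pow_strict_mono_def)
  moreover have "defect n \<in> stable_defects_class (int (complexity n + 0))"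
  proof -
    have "n > 0" "n \<noteq> 1" using 0 stable_neq_1 by (auto simp: stable_def)
    then show ?thesis
      using 0 unfolding stable_defects_class_def defects_class_def stable_defects_def
      by (intro IntI CollectI exI[of _ n]) auto
  qed
  ultimately show ?case using 0 by (intro exI[of _ "\<lambda>xs. defect n"]) auto
next
  case (Suc k)
  have n: "n > 0" using Suc.prems by (simp add: stable_def)
  obtain E where E: "\<And>e. E \<le> e \<Longrightarrow> stable (3 ^ e * n + 1)"
    "\<And>e. E \<le> e \<Longrightarrow> complexity (3 ^ e * n + 1) = 3 * e + complexity n + 1"
    using stable_succ[OF Suc.prems(1)] by blast
  have "v - real k < defect n + 1" using Suc.prems(2) by simp
  then have "eventually (\<lambda>e. v - real k < succ_defect n e) sequentially"
    using succ_defect_tendsto[OF n] by (simp add: order_tendsto_iff)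
  then obtain e0 where e0: "\<And>e. e0 \<le> e \<Longrightarrow> v - real k < succ_defect n e"
    unfolding eventually_sequentially by blast
  \<comment> \<open>Exponents past \<open>E\<close> give stability; those past \<open>e0\<close>
    leave room above \<open>v\<close>.\<close>
  define e where "e i = max E e0 + i" for i
  define c where "c i = 3 ^ e i * n + 1" for i
  have c: "stable (c i)" "complexity (c i) = 3 * e i + complexity n + 1"
    "defect (c i) = succ_defect n (e i)" "v < defect (c i) + real k" for i
  proof -
    show "stable (c i)" and compl: "complexity (c i) = 3 * e i + complexity n + 1"
      using E by (auto simp: c_def e_def)
    show eq: "defect (c i) = succ_defect n (e i)"
      using compl unfolding succ_defect_eq[OF n] defect_def c_def[symmetric] by simp
    have "e0 \<le> e i" by (simp add: e_def)
    then show "v < defect (c i) + real k" using e0[of "e i"] eq by simp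
  qed
  have mono: "defect (c i) < defect (c j)" if "i < j" for i j
    using that unfolding c(3) by (intro succ_defect_strict_mono[OF n]) (simp add: e_def)
  \<comment> \<open>The lower bound for block \<open>i\<close>: the upper bound of the preceding
    block, or \<open>v\<close> for the first.\<close>
  define w where "w i = (if i = 0 then v else defect (c (i - 1)) + real k)" for i
  have w: "w i < defect (c i) + real k" "v \<le> w i" for i
    using c(4) mono[of "i - 1" i] by (auto simp: w_def intro: less_imp_le)
  have "\<exists>f. omega_pow_strict_mono k f \<and>
      (\<forall>xs. length xs = k \<longrightarrow> f xs \<in> stable_defects_class (int (complexity (c i) + k)) \<and>
         w i < f xs \<and> f xs \<le> defect (c i) + real k)" for i
    using Suc.IH[OF c(1) w(1)] .
  then obtain g where g: "\<And>i. omega_pow_strict_mono k (g i)"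
    "\<And>i xs. length xs = k \<Longrightarrow> g i xs \<in> stable_defects_class (int (complexity (c i) + k))"
    "\<And>i xs. length xs = k \<Longrightarrow> w i < g i xs"
    "\<And>i xs. length xs = k \<Longrightarrow> g i xs \<le> defect (c i) + real k"
    by metis
  define f where "f ys = g (hd ys) (tl ys)" for ys
  have "omega_pow_strict_mono (Suc k) f"
    unfolding omega_pow_strict_mono_def
  proof (intro allI impI, elim conjE)
    fix xs ys assume *: "(xs, ys) \<in> omega_pow (Suc k)" "xs \<noteq> ys"
    then have "length xs = Suc k" "length ys = Suc k"
      using FieldI1[OF *(1)] FieldI2[OF *(1)] unfolding Field_omega_pow by auto
    then obtain i xs' j ys' where eq: "xs = i # xs'" "ys = j # ys'" and len: "length xs' = k" "length ys' = k"
      by (auto simp: length_Suc_conv)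
    from *(1) consider "i < j" | "i = j" "(xs', ys') \<in> omega_pow k"
      unfolding eq omega_pow_Cons by blast
    then show "f xs < f ys"
    proof cases
      case 1
      have "g i xs' \<le> defect (c i) + real k" using g(4) len by simp
      also have "\<dots> \<le> defect (c (j - 1)) + real k"
      proof -
        have "i < j - 1 \<or> i = j - 1" using 1 by linarith
        then show ?thesis using mono by (auto intro: less_imp_le)
      qed
      also have "\<dots> = w j" using 1 by (simp add: w_def)
      also have "\<dots> < g j ys'" using g(3) len by simp
      finally show ?thesis by (simp add: f_def eq)
    next
      case 2
      then show ?thesis using g(1)[of j] *(2) by (simp add: f_def eq omega_pow_strict_mono_def)
    qed
  qed
  moreover have "f xs \<in> stable_defects_class (int (complexity n + Suc k)) \<and>
      v < f xs \<and> f xs \<le> defect n + real (Suc k)" if len: "length xs = Suc k" for xs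
  proof -
    obtain i xs' where xs: "xs = i # xs'" "length xs' = k"
      using len by (auto simp: length_Suc_conv)
    have "[int (complexity (c i) + k) = int (complexity n + Suc k)] (mod 3)"
      unfolding c(2) cong_iff_dvd_diff by simp
    then have "stable_defects_class (int (complexity (c i) + k)) =
        stable_defects_class (int (complexity n + Suc k))"
      by (rule stable_defects_class_cong)
    moreover have "defect (c i) \<le> defect n + 1"
      unfolding c(3) using succ_defect_less[OF n] by (rule less_imp_le)
    ultimately show ?thesis
      using g(2-4)[OF xs(2), of i] w(2)[of i] by (auto simp: f_def xs)
  qed
  ultimately show ?case by blast
qed

section \<open>Comparing a set of reals with \<omega>^k\<close>

lemma Field_relation_of_le: "Field (relation_of (\<le>) S) = (S :: real set)"
  by (auto simp: Field_def relation_of_def)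

lemma Well_order_relation_of_le:
  fixes S :: "real set"
  assumes "\<And>T. \<lbrakk>T \<subseteq> S; T \<noteq> {}\<rbrakk> \<Longrightarrow> \<exists>t\<in>T. \<forall>t'\<in>T. t \<le> t'"
  shows "Well_order (relation_of (\<le>) S)"
proof -
  have "wf (relation_of (\<le>) S - Id)"
    unfolding wf_eq_minimal
  proof (intro allI impI)
    fix Q :: "real set" and x assume "x \<in> Q"
    show "\<exists>z\<in>Q. \<forall>y. (y, z) \<in> relation_of (\<le>) S - Id \<longrightarrow> y \<notin> Q"
    proof (cases "Q \<inter> S = {}")
      case True
      then show ?thesis using \<open>x \<in> Q\<close> by (auto simp: relation_of_def)
    next
      case False
      then obtain t where "t \<in> Q \<inter> S" "\<forall>t'\<in>Q \<inter> S. t \<le> t'"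
        using assms[of "Q \<inter> S"] by auto
      then show ?thesis by (intro bexI[of _ t]) (force simp: relation_of_def)+
    qed
  qed
  moreover have "Linear_order (relation_of (\<le>) S)"
    unfolding order_on_defs Field_relation_of_le
    by (auto simp: relation_of_def refl_on_def trans_def antisym_def total_on_def)
  ultimately show ?thesis by (simp add: well_order_on_def)
qed

text \<open>Well-orders are comparable, so it suffices to refute both strict comparisons. If
  \<omega>^k were shorter, it would embed below some \<open>x\<close> of \<open>S\<close>, against
  \<open>no_longer\<close>. If \<open>S\<close> were shorter, composing with \<open>f\<close> would
  give a strictly increasing self-map of \<omega>^k that lowers a point.\<close>

lemma has_order_type_omega_powI:
  fixes S :: "real set"
  assumes least: "\<And>T. \<lbrakk>T \<subseteq> S; T \<noteq> {}\<rbrakk> \<Longrightarrow> \<exists>t\<in>T. \<forall>t'\<in>T. t \<le> t'"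
    and f: "omega_pow_strict_mono k f" "\<And>xs. length xs = k \<Longrightarrow> f xs \<in> S"
    and no_longer: "\<And>g x. \<lbrakk>omega_pow_strict_mono k g; \<And>xs. length xs = k \<Longrightarrow> g xs \<in> S; x \<in> S;
      \<And>xs. length xs = k \<Longrightarrow> g xs < x\<rbrakk> \<Longrightarrow> False"
  shows "has_order_type S (omega_pow k)"
proof -
  let ?r = "relation_of (\<le>) S" and ?w = "omega_pow k"
  note r = Well_order_relation_of_le[OF least]
  note w = Well_order_omega_pow[of k]
  have "\<not> ?w <o ?r"
  proof
    assume "?w <o ?r"
    then obtain x where x: "x \<in> S" "?w =o Restr ?r (underS ?r x)"
      using ordLess_iff_ordIso_Restr[OF r w] Field_relation_of_le by blast
    then obtain g where iso: "iso ?w (Restr ?r (underS ?r x)) g"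
      unfolding ordIso_def by blast
    have g: "(g xs, g ys) \<in> Restr ?r (underS ?r x)" if "(xs, ys) \<in> ?w" for xs ys
      using iso_forward[OF that iso] .
    have "(xs, xs) \<in> ?w" if "length xs = k" for xs
      using w that Field_omega_pow[of k] by (auto simp: order_on_defs refl_on_def)
    then have g_less: "g xs \<in> S \<and> g xs < x" if "length xs = k" for xs
      using g[of xs xs] that by (auto simp: relation_of_def underS_def)
    have "inj_on g (Field ?w)" using iso by (auto simp: iso_iff2 bij_betw_def)
    then have "g xs < g ys" if "(xs, ys) \<in> ?w" "xs \<noteq> ys" for xs ys
      using g[OF that(1)] that FieldI1[OF that(1)] FieldI2[OF that(1)]
      by (force simp: relation_of_def inj_on_def)
    then have "omega_pow_strict_mono k g" by (simp add: omega_pow_strict_mono_def)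
    then show False using no_longer[of g x] g_less x(1) by blast
  qed
  moreover have "\<not> ?r <o ?w"
  proof
    assume "?r <o ?w"
    then obtain a where a: "a \<in> Field ?w" "?r =o Restr ?w (underS ?w a)"
      using ordLess_iff_ordIso_Restr[OF w r] by blast
    then obtain h where iso: "iso ?r (Restr ?w (underS ?w a)) h"
      unfolding ordIso_def by blast
    have h: "(h x, h y) \<in> Restr ?w (underS ?w a)" if "x \<in> S" "y \<in> S" "x \<le> y" for x y
      using iso_forward[OF _ iso, of x y] that by (auto simp: relation_of_def)
    have h_inj: "inj_on h S" using iso Field_relation_of_le by (auto simp: iso_iff2 bij_betw_def)
    have fS: "f xs \<in> S" if "xs \<in> Field ?w" for xs
      using that f(2) by (simp add: Field_omega_pow)
    have hf_mono: "(h (f xs), h (f ys)) \<in> ?w - Id" if "(xs, ys) \<in> ?w - Id" for xs ys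
    proof -
      have "f xs < f ys" using f(1) that by (auto simp: omega_pow_strict_mono_def)
      moreover have "f xs \<in> S" "f ys \<in> S"
        using fS FieldI1[of xs ys ?w] FieldI2[of xs ys ?w] that by blast+
      ultimately show ?thesis using h[of "f xs" "f ys"] inj_onD[OF h_inj, of "f xs" "f ys"] by auto
    qed
    have wf: "wf (?w - Id)" using w by (simp add: order_on_defs)
    have "(h (f a), a) \<in> ?w - Id"
      using h[of "f a" "f a"] fS[OF a(1)] by (auto simp: underS_def)
    then have "a \<in> {x. (h (f x), x) \<in> ?w - Id}" by simp
    from wfE_min[OF wf this] obtain z where z: "z \<in> {x. (h (f x), x) \<in> ?w - Id}"
      "\<And>y. (y, z) \<in> ?w - Id \<Longrightarrow> y \<notin> {x. (h (f x), x) \<in> ?w - Id}"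
      by blast
    then have "(h (f z), z) \<in> ?w - Id" by simp
    \<comment> \<open>By monotonicity the smaller point \<open>h (f z)\<close> is lowered as well,
      against the minimality of \<open>z\<close>.\<close>
    then show False using hf_mono[of "h (f z)" z] z(2)[of "h (f z)"] by simp
  qed
  ultimately show ?thesis
    unfolding has_order_type_def using ordLess_or_ordLeq[OF r w] ordLeq_iff_ordLess_or_ordIso
      ordIso_symmetric by metis
qed

theorem theorem4p1:
  fixes k :: nat and a :: int
  shows "has_order_type (defects_class a \<inter> {0..threshold a k}) (omega_pow k)
       \<and> has_order_type (stable_defects_class a \<inter> {0..threshold a k}) (omega_pow k)"
proof -
  let ?I = "{0..threshold a k}"
  obtain n where n: "n \<in> {2, 3, 4}" "threshold a k = defect n + real k"
    "[int (complexity n + k) = a] (mod 3)"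
    by (rule threshold_eq_defect)
  have "defect n < 1"
    using n(1) log3_2_bounds by (auto simp: defect_2 defect_3 defect_4)
  then have "stable n" using n(1) by (intro stable_if_defect_less_1) auto
  \<comment> \<open>The subtracted 1 is an arbitrary choice: any lower bound strictly below the
    threshold would do.\<close>
  then obtain f where f: "omega_pow_strict_mono k f"
    "\<And>xs. length xs = k \<Longrightarrow> f xs \<in> stable_defects_class (int (complexity n + k))"
    "\<And>xs. length xs = k \<Longrightarrow> f xs \<le> defect n + real k"
    using omega_pow_of_stable_defects[of n "defect n + real k - 1" k] by auto
  have sub: "stable_defects_class a \<subseteq> defects_class a" by (simp add: stable_defects_class_def)
  have f_in: "f xs \<in> stable_defects_class a \<inter> ?I" if "length xs = k" for xs
  proof -
    have *: "f xs \<in> stable_defects_class a"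
      using f(2)[OF that] stable_defects_class_cong[OF n(3)] by simp
    moreover from this have "0 \<le> f xs"
      using sub defect_nonneg unfolding defects_class_def by auto
    ultimately show ?thesis using f(3)[OF that] n(2) by simp
  qed
  \<comment> \<open>Both claims at once: the copy of \<omega>^k consists of stable defects, while
    the upper bound holds for all defects of the class, so every set in between has the same
    type.\<close>
  have "has_order_type S (omega_pow k)"
    if S: "stable_defects_class a \<inter> ?I \<subseteq> S" "S \<subseteq> defects_class a \<inter> ?I" for S
  proof (rule has_order_type_omega_powI)
    show "\<exists>t\<in>T. \<forall>t'\<in>T. t \<le> t'" if "T \<subseteq> S" "T \<noteq> {}" for T
      using that S(2) by (intro defects_least) (auto simp: defects_class_def)
    show "omega_pow_strict_mono k f" by fact
    show "f xs \<in> S" if "length xs = k" for xs using f_in[OF that] S(1) by blast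
    show False if "omega_pow_strict_mono k g" "\<And>xs. length xs = k \<Longrightarrow> g xs \<in> S" "x \<in> S"
      "\<And>xs. length xs = k \<Longrightarrow> g xs < x" for g x
      using that S(2) by (intro no_omega_pow_below_defect[of k g a x]) auto
  qed
  moreover have "stable_defects_class a \<inter> ?I \<subseteq> defects_class a \<inter> ?I" using sub by auto
  ultimately show ?thesis by (meson order.refl)
qed

end
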